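(* Let $A=\{a_1,\ldots,a_m\}$ be a finite set of distinct real numbers. For any region $R$ of $\mathcal{B}_n^A$, the level of $R$ equals the number of strong components of the weighted digraph $D(R)$.
   Context: $\mathcal{B}_n^A$ is the hyperplane arrangement in $\mathbb{R}^n$ with hyperplanes $x_i-x_j=a$ for $1\le i<j\le n$, $a\in A$; a region is a connected component of the complement of their union. Order $A$ as $a_1<\cdots<a_m$. Every region $R$ is the solution set of a system $m_{ij}<x_i-x_j<M_{ij}$ ($1\le i<j\le n$), where each $m_{ij}\in\{-\infty\}\cup A$ and $M_{ij}=a_1$ if $m_{ij}=-\infty$, $M_{ij}=a_{k+1}$ if $m_{ij}=a_k$ with $k<m$, $M_{ij}=\infty$ if $m_{ij}=a_m$. The weighted digraph $D(R)$ on vertex set $[n]$ has, for each $i<j$, an edge $i\to j$ of weight $m_{ij}$ if $m_{ij}>-\infty$ and an edge $j\to i$ of weight $-M_{ij}$ if $M_{ij}<\infty$. A strong component is a maximal strongly connected subdigraph. The level $l(X)$ of $X\subseteq\mathbb{R}^n$ is the smallest non-negative integer $l$ such that there exist a linear subspace $W$ of dimension $l$ and $r>0$ with $X\subseteq\{\bm x:\min_{\bm w\in W}\|\bm x-\bm w\|\le r\}$. *)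

theory Defs
  imports "Graph_Theory.Digraph_Component" "HOL-Analysis.Analysis"
begin

text \<open>
  The index set \<open>[n]\<close> is an arbitrary finite linearly ordered type \<open>'n\<close>, with \<open>n = CARD('n)\<close>.
\<close>

definition arrangement :: "real set \<Rightarrow> (real ^ 'n::{finite,linorder}) set set" where
  "arrangement A = {{x. x $ i - x $ j = a} | i j a. i < j \<and> a \<in> A}"

definition regions :: "real set \<Rightarrow> (real ^ 'n::{finite,linorder}) set set" where
  "regions A = components (- \<Union> (arrangement A))"

text \<open>
  For \<open>A = {a\<^sub>1 < \<dots> < a\<^sub>m}\<close> this sends \<open>-\<infinity>\<close> to \<open>a\<^sub>1\<close>, \<open>a\<^sub>k\<close> to \<open>a\<^sub>k\<^sub>+\<^sub>1\<close> for \<open>k < m\<close>, and \<open>a\<^sub>m\<close> to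
  \<open>\<infinity>\<close>; if \<open>A\<close> is empty, \<open>-\<infinity>\<close> is sent to \<open>\<infinity>\<close>.
\<close>

definition next_bound :: "real set \<Rightarrow> ereal \<Rightarrow> ereal" where
  "next_bound A c =
     (if \<exists>a\<in>A. c < ereal a then ereal (Min {a \<in> A. c < ereal a}) else \<infinity>)"

text \<open>Only the values \<open>m i j\<close> with \<open>i < j\<close> are relevant.\<close>

definition is_region_system ::
  "real set \<Rightarrow> (real ^ 'n::{finite,linorder}) set \<Rightarrow> ('n \<Rightarrow> 'n \<Rightarrow> ereal) \<Rightarrow> bool" where
  "is_region_system A R m \<longleftrightarrow>
     (\<forall>i j. i < j \<longrightarrow> m i j \<in> insert (-\<infinity>) (ereal ` A)) \<and>
     R = {x. \<forall>i j. i < j \<longrightarrow>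
            m i j < ereal (x $ i - x $ j) \<and> ereal (x $ i - x $ j) < next_bound A (m i j)}"

text \<open>
  For finite \<open>A\<close> and every region \<open>R\<close> such a system exists and its values for \<open>i < j\<close> are determined
  by \<open>R\<close>; both facts are proved below.
\<close>

definition lower_bounds ::
  "real set \<Rightarrow> (real ^ 'n::{finite,linorder}) set \<Rightarrow> 'n \<Rightarrow> 'n \<Rightarrow> ereal" where
  "lower_bounds A R = (SOME m. is_region_system A R m)"

definition upper_bounds ::
  "real set \<Rightarrow> (real ^ 'n::{finite,linorder}) set \<Rightarrow> 'n \<Rightarrow> 'n \<Rightarrow> ereal" where
  "upper_bounds A R i j = next_bound A (lower_bounds A R i j)"

text \<open>An arc \<open>(u, v, w)\<close> is an edge from \<open>u\<close> to \<open>v\<close> of weight \<open>w\<close>.\<close>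

definition region_digraph ::
  "real set \<Rightarrow> (real ^ 'n::{finite,linorder}) set \<Rightarrow> ('n, 'n \<times> 'n \<times> real) pre_digraph" where
  "region_digraph A R =
     \<lparr> verts = UNIV,
       arcs = {(i, j, real_of_ereal (lower_bounds A R i j)) | i j. i < j \<and> lower_bounds A R i j > -\<infinity>} \<union>
              {(j, i, - real_of_ereal (upper_bounds A R i j)) | i j. i < j \<and> upper_bounds A R i j < \<infinity>},
       tail = (\<lambda>(u, v, w). u),
       head = (\<lambda>(u, v, w). v) \<rparr>"

text \<open>
  The distance \<open>infdist x W\<close> is the minimum of \<open>norm (x - w)\<close> over \<open>w \<in> W\<close>, since subspaces are
  closed; see the lemma \<open>infdist_subspace_attained\<close> below.
\<close>

definition level :: "(real ^ 'n) set \<Rightarrow> nat" where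
  "level X = (LEAST l. \<exists>W r. subspace W \<and> dim W = l \<and> r > 0 \<and> X \<subseteq> {x. infdist x W \<le> r})"

lemma infdist_subspace_attained:
  fixes W :: "(real ^ 'n) set"
  assumes "subspace W"
  shows "\<exists>w\<in>W. infdist x W = norm (x - w) \<and> (\<forall>w'\<in>W. norm (x - w) \<le> norm (x - w'))"
proof -
  have "closed W" "W \<noteq> {}"
    using assms closed_subspace subspace_0 by auto
  then obtain w where w: "w \<in> W" "infdist x W = dist x w"
    by (metis infdist_attains_inf)
  then show ?thesis
    by (metis dist_norm infdist_le)
qed

lemma next_bound_gt: "finite A \<Longrightarrow> c \<noteq> \<infinity> \<Longrightarrow> c < next_bound A c"
  using Min_in[of "{a \<in> A. c < ereal a}"] by (auto simp: next_bound_def)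

lemma next_bound_le: "finite A \<Longrightarrow> a \<in> A \<Longrightarrow> c < ereal a \<Longrightarrow> next_bound A c \<le> ereal a"
  by (auto simp: next_bound_def)

lemma next_bound_cases:
  "finite A \<Longrightarrow> next_bound A c = \<infinity> \<or> (\<exists>a\<in>A. next_bound A c = ereal a)"
  using Min_in[of "{a \<in> A. c < ereal a}"] by (auto simp: next_bound_def)

lemma is_region_system_unique:
  fixes R :: "(real ^ 'n::{finite,linorder}) set"
  assumes "finite A" "R \<noteq> {}" "is_region_system A R m" "is_region_system A R m'" "i < j"
  shows "m i j = m' i j"
proof -
  have *: "c \<le> c'"
    if h: "x \<in> R" "c \<in> insert (-\<infinity>) (ereal ` A)" "c < ereal (x $ i - x $ j)"
      "ereal (x $ i - x $ j) < next_bound A c'" for c c' x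
  proof (rule ccontr)
    assume "\<not> c \<le> c'"
    then obtain a where "a \<in> A" "c = ereal a" "c' < ereal a"
      using h by (auto simp: not_le)
    then have "next_bound A c' \<le> c"
      using next_bound_le assms(1) by blast
    then show False
      using h(3,4) by (meson leD less_trans)
  qed
  obtain x where x: "x \<in> R"
    using assms by auto
  have sys: "k i j \<in> insert (-\<infinity>) (ereal ` A)" "k i j < ereal (x $ i - x $ j)"
    "ereal (x $ i - x $ j) < next_bound A (k i j)" if "is_region_system A R k" for k
    using that x \<open>i < j\<close> unfolding is_region_system_def by blast+
  show ?thesis
    using sys[OF assms(3)] sys[OF assms(4)] *[OF x] by (meson antisym)
qed

lemma is_region_system_exists:
  fixes R :: "(real ^ 'n::{finite,linorder}) set"
  assumes fin: "finite A" and R: "R \<in> regions A"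
  shows "\<exists>m. is_region_system A R m"
proof -
  from R obtain x where x: "x \<in> R"
    unfolding regions_def using in_components_nonempty by fastforce
  define B where "B i j = insert (-\<infinity>) (ereal ` {a \<in> A. a < x $ i - x $ j})" for i j
  define m where "m i j = Max (B i j)" for i j
  define C where "C = {y::(real, 'n) vec. \<forall>i j. i < j \<longrightarrow>
      m i j < ereal (y $ i - y $ j) \<and> ereal (y $ i - y $ j) < next_bound A (m i j)}"
  have finB: "finite (B i j)" and neB: "B i j \<noteq> {}" for i j
    using fin by (auto simp: B_def)
  have mB: "m i j \<in> B i j" for i j
    unfolding m_def using finB neB by (rule Max_in)
  then have mA: "m i j \<in> insert (-\<infinity>) (ereal ` A)" for i j
    using mB[of i j] by (auto simp: B_def)
  have off: "y $ i - y $ j \<noteq> a" if "y \<in> R" "i < j" "a \<in> A" for y i j a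
  proof
    assume "y $ i - y $ j = a"
    then have "y \<in> \<Union> (arrangement A)"
      using that unfolding arrangement_def by blast
    then show False
      using that(1) in_components_subset[OF R[unfolded regions_def]] by blast
  qed
  have conR: "Topological_Spaces.connected R"
    using R in_components_connected unfolding regions_def by blast
  have conD: "Topological_Spaces.connected ((\<lambda>y. y $ i - y $ j) ` R)" for i j
    by (intro connected_continuous_image conR continuous_intros)
  have xm: "m i j < ereal (x $ i - x $ j)" for i j
    using mB[of i j] by (auto simp: B_def)
  have xM: "ereal (x $ i - x $ j) < next_bound A (m i j)" if "i < j" for i j
  proof (rule ccontr)
    assume "\<not> ?thesis"
    then obtain a where a: "a \<in> A" "next_bound A (m i j) = ereal a" "a \<le> x $ i - x $ j"
      using next_bound_cases[OF fin, of "m i j"] by auto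
    then have "ereal a \<in> B i j"
      using off[OF x that a(1)] by (auto simp: B_def)
    then have "ereal a \<le> m i j"
      unfolding m_def using finB by auto
    moreover have "m i j < ereal a"
      using next_bound_gt[OF fin, of "m i j"] a mA[of i j] by auto
    ultimately show False by auto
  qed
  have "x \<in> C"
    using xm xM by (auto simp: C_def)
  have "convex C"
  proof -
    have lin: "linear (\<lambda>y::(real, 'n) vec. y $ i - y $ j)" for i j
      by (intro linearI) (auto simp: algebra_simps)
    have int: "convex {t::real. c < ereal t \<and> ereal t < d}" for c d
      unfolding is_interval_convex_1[symmetric] is_interval_1
    proof clarify
      fix s t u assume "c < ereal s" "ereal t < d" "s \<le> u" "u \<le> t"
      then show "c < ereal u \<and> ereal u < d"
        by (cases c; cases d) auto
    qed
    have "C = (\<Inter>i. \<Inter>j\<in>{j. i < j}. (\<lambda>y. y $ i - y $ j) -`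
        {t. m i j < ereal t \<and> ereal t < next_bound A (m i j)})"
      by (auto simp: C_def)
    then show ?thesis
      by (simp only:) (intro convex_INT convex_linear_vimage[OF lin] int)
  qed
  have "C \<subseteq> R"
  proof (rule components_maximal[OF R[unfolded regions_def]])
    show "Topological_Spaces.connected C"
      using \<open>convex C\<close> by (rule convex_connected)
    show "R \<inter> C \<noteq> {}"
      using x \<open>x \<in> C\<close> by blast
    show "C \<subseteq> - \<Union> (arrangement A)"
    proof (clarsimp simp: arrangement_def)
      fix y i j assume y: "y \<in> C" "(i::'n) < j" "y $ i - y $ j \<in> A"
      then have "next_bound A (m i j) \<le> ereal (y $ i - y $ j)"
        by (intro next_bound_le[OF fin]) (auto simp: C_def)
      then show False
        using y by (auto simp: C_def not_less[symmetric] simp del: not_less)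
    qed
  qed
  moreover have "R \<subseteq> C"
    unfolding C_def
  proof (clarify, rule conjI)
    fix y i j assume y: "y \<in> R" "(i::'n) < j"
    let ?D = "(\<lambda>y. y $ i - y $ j) ` R"
    have seg: "False" if "a \<in> A" "s \<in> ?D" "t \<in> ?D" "s \<le> a" "a \<le> t" for a s t
    proof -
      have "a \<in> ?D"
        using connected_contains_Icc[OF conD that(2,3)] that(4,5) by (auto simp: subset_iff)
      then show False
        using off[OF _ y(2) that(1)] by blast
    qed
    show "m i j < ereal (y $ i - y $ j)"
    proof (rule ccontr)
      assume n: "\<not> ?thesis"
      then obtain a where "a \<in> A" "m i j = ereal a"
        using mA[of i j] by auto
      then show False
        using n xm[of i j] seg[of a "y $ i - y $ j" "x $ i - x $ j"] x y by auto
    qed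
    show "ereal (y $ i - y $ j) < next_bound A (m i j)"
    proof (rule ccontr)
      assume n: "\<not> ?thesis"
      then obtain a where "a \<in> A" "next_bound A (m i j) = ereal a"
        using next_bound_cases[OF fin, of "m i j"] by auto
      then show False
        using n xM[OF y(2)] seg[of a "x $ i - x $ j" "y $ i - y $ j"] x y by auto
    qed
  qed
  ultimately have "R = C" by blast
  then have "is_region_system A R m"
    using mA by (simp add: is_region_system_def C_def)
  then show ?thesis by blast
qed

lemma is_region_system_lower_bounds:
  assumes "finite A" "R \<in> regions A"
  shows "is_region_system A R (lower_bounds A R)"
  unfolding lower_bounds_def using is_region_system_exists[OF assms] by (rule someI_ex)

end

theory Submission
  imports Defs "HOL-Library.Disjoint_Sets"
begin

text \<open>
  Let \<open>W\<^sub>0\<close> be the space of vectors that are constant on the strong components of the digraph, so that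
  its dimension is the number of strong components. An arc from \<open>i\<close> to \<open>j\<close> bounds
  \<open>x $ i - x $ j\<close> from below on the region, so coordinate differences inside a strong component are
  bounded and the region stays within bounded distance of \<open>W\<^sub>0\<close>. Conversely, a subspace \<open>W\<close>
  within bounded distance of the region contains every recession direction, that is, every \<open>y\<close>
  with \<open>y $ i \<ge> y $ j\<close> for all arcs from \<open>i\<close> to \<open>j\<close>. The vector counting the vertices reachable
  from each vertex is a recession direction that drops by at least 1 along each arc between different
  components. Hence every element of \<open>W\<^sub>0\<close> is a difference of two recession directions,
  and \<open>W\<^sub>0 \<subseteq> W\<close>.
\<close>

section \<open>Block-constant vectors and strong components\<close>

text \<open>The indicator vectors of the blocks form a basis: they are nonzero and pairwise
  orthogonal because blocks are nonempty and disjoint, and they span because the blocks cover every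
  index.\<close>

lemma dim_constant_on_blocks:
  fixes P :: "'n::finite set set"
  assumes P: "partition_on UNIV P"
  shows "dim {x :: real ^ 'n. \<forall>S\<in>P. \<forall>i\<in>S. \<forall>j\<in>S. x $ i = x $ j} = card P" (is "dim ?W = _")
proof (rule dim_unique)
  define ind where "ind S = (\<chi> i. if i \<in> S then 1 else (0::real))" for S :: "'n set"
  have ne: "S \<noteq> {}" if "S \<in> P" for S
    using P that by (auto dest: partition_onD3)
  have disj: "S = T" if "S \<in> P" "T \<in> P" "i \<in> S" "i \<in> T" for S T i
    using partition_onD2[OF P] that unfolding disjoint_def by blast
  have inj: "inj_on ind P"
  proof (rule inj_onI)
    fix S T assume "ind S = ind T"
    then have "i \<in> S \<longleftrightarrow> i \<in> T" for i
      by (auto simp: ind_def vec_eq_iff split: if_splits)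
    then show "S = T" by blast
  qed
  show "ind ` P \<subseteq> ?W"
    using disj by (fastforce simp: ind_def)
  show "independent (ind ` P)"
  proof (rule pairwise_orthogonal_independent)
    show "pairwise orthogonal (ind ` P)"
      using disj by (fastforce simp: pairwise_def orthogonal_def ind_def inner_vec_def intro!: sum.neutral)
    show "0 \<notin> ind ` P"
    proof
      assume "0 \<in> ind ` P"
      then obtain S where S: "S \<in> P" "ind S = 0" by auto
      then obtain i where "i \<in> S"
        using ne by blast
      then have "ind S $ i = 1"
        by (simp add: ind_def)
      then show False
        using S by simp
    qed
  qed
  show "card (ind ` P) = card P"
    using inj by (rule card_image)
  show "?W \<subseteq> span (ind ` P)"
  proof
    fix x assume x: "x \<in> ?W"
    \<comment> \<open>The choice of index is harmless, since \<open>x\<close> takes a single value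
      on each block.\<close>
    define c where "c S = x $ (SOME i. i \<in> S)" for S
    have c: "c S = x $ i" if "S \<in> P" "i \<in> S" for S i
      using x that someI[of "\<lambda>i. i \<in> S" i] unfolding c_def by blast
    have "x = (\<Sum>S\<in>P. c S *\<^sub>R ind S)"
    proof (rule vec_eq_iff[THEN iffD2], rule allI)
      fix i
      obtain S where S: "S \<in> P" "i \<in> S"
        using P by (auto dest: partition_onD1)
      have "(\<Sum>T\<in>P. c T *\<^sub>R ind T) $ i = (\<Sum>T\<in>P. if T = S then c S else 0)"
        unfolding sum_component using S
        by (intro sum.cong) (auto simp: ind_def dest: disj[OF _ S(1) _ S(2)])
      also have "\<dots> = x $ i"
        using S c by simp
      finally show "x $ i = (\<Sum>T\<in>P. c T *\<^sub>R ind T) $ i" by simp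
    qed
    moreover have "(\<Sum>S\<in>P. c S *\<^sub>R ind S) \<in> span (ind ` P)"
      by (intro span_sum span_scale span_base imageI)
    ultimately show "x \<in> span (ind ` P)" by (rule ssubst)
  qed
qed

lemma (in wf_digraph) partition_on_sccs_verts: "partition_on (verts G) sccs_verts"
proof (rule partition_onI)
  have "scc_of v \<in> sccs_verts \<and> v \<in> scc_of v" if "v \<in> verts G" for v
    using that unfolding sccs_verts_def scc_of_def by (auto intro: reachable_trans)
  moreover have "S \<subseteq> verts G" if "S \<in> sccs_verts" for S
    using that reachable_in_verts unfolding sccs_verts_def by blast
  ultimately show "\<Union> sccs_verts = verts G" by blast
  show "disjnt S T" if "S \<in> sccs_verts" "T \<in> sccs_verts" "S \<noteq> T" for S T
    using sccs_verts_disjoint that by (simp add: disjnt_def)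
  show "{} \<notin> sccs_verts"
    by (simp add: sccs_verts_def)
qed

text \<open>Lets the later arguments work with mutual reachability alone and meet the components
  only when counting dimensions.\<close>

lemma (in wf_digraph) constant_on_sccs_verts_iff:
  "(\<forall>S\<in>sccs_verts. \<forall>i\<in>S. \<forall>j\<in>S. f i = f j) \<longleftrightarrow> (\<forall>i j. i \<rightarrow>\<^sup>* j \<longrightarrow> j \<rightarrow>\<^sup>* i \<longrightarrow> f i = f j)"
proof (intro iffI allI impI)
  fix i j assume *: "\<forall>S\<in>sccs_verts. \<forall>i\<in>S. \<forall>j\<in>S. f i = f j" and ij: "i \<rightarrow>\<^sup>* j" "j \<rightarrow>\<^sup>* i"
  obtain S where S: "S \<in> sccs_verts" "i \<in> S"
    using partition_onD1[OF partition_on_sccs_verts] reachable_in_verts[OF ij(1)] by auto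
  then have "j \<in> S"
    using ij by (auto simp: sccs_verts_def)
  with S * show "f i = f j" by blast
next
  assume "\<forall>i j. i \<rightarrow>\<^sup>* j \<longrightarrow> j \<rightarrow>\<^sup>* i \<longrightarrow> f i = f j"
  then show "\<forall>S\<in>sccs_verts. \<forall>i\<in>S. \<forall>j\<in>S. f i = f j"
    by (simp add: sccs_verts_def)
qed

section \<open>Recession directions near a subspace\<close>

text \<open>If \<open>w\<close> is a point of \<open>W\<close> nearest to
  \<open>x + t *\<^sub>R y\<close>, then \<open>w /\<^sub>R t\<close> lies in \<open>W\<close>
  within \<open>(r + norm x) / t\<close> of \<open>y\<close>. Letting \<open>t\<close> grow,
  \<open>y\<close> has distance 0 from the closed set \<open>W\<close>.\<close>

lemma recession_direction_in_subspace:
  fixes W :: "'a::euclidean_space set"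
  assumes W: "subspace W" and bound: "\<And>t. t \<ge> 0 \<Longrightarrow> infdist (x + t *\<^sub>R y) W \<le> r"
  shows "y \<in> W"
proof -
  have cl: "closed W" "W \<noteq> {}"
    using W closed_subspace subspace_0 by auto
  have le: "infdist y W \<le> (r + norm x) / t" if "t > 0" for t
  proof -
    obtain w where w: "w \<in> W" "infdist (x + t *\<^sub>R y) W = dist (x + t *\<^sub>R y) w"
      using cl by (metis infdist_attains_inf)
    have "t * norm (y - w /\<^sub>R t) = norm (t *\<^sub>R (y - w /\<^sub>R t))"
      using that by simp
    also have "\<dots> = norm ((x + t *\<^sub>R y - w) - x)"
      using that by (simp add: algebra_simps)
    also have "\<dots> \<le> norm (x + t *\<^sub>R y - w) + norm x"
      by (rule norm_triangle_ineq4)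
    also have "\<dots> \<le> r + norm x"
      using w bound[of t] that by (simp add: dist_norm)
    finally have "norm (y - w /\<^sub>R t) \<le> (r + norm x) / t"
      using that by (simp add: field_simps)
    moreover have "infdist y W \<le> dist y (w /\<^sub>R t)"
      using W w by (intro infdist_le) (simp add: subspace_scale)
    ultimately show ?thesis by (simp add: dist_norm)
  qed
  have "((\<lambda>t. (r + norm x) / t) \<longlongrightarrow> 0) at_top"
    by (intro tendsto_divide_0[OF tendsto_const] filterlim_at_top_imp_at_infinity filterlim_ident)
  then have "infdist y W \<le> 0"
    by (rule tendsto_lowerbound) (auto intro: eventually_mono[OF eventually_gt_at_top[of 0]] le)
  then have "infdist y W = 0"
    using infdist_nonneg[of y W] by simp
  then show "y \<in> W"
    using cl in_closed_iff_infdist_zero by blast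
qed

section \<open>Arcs and the inequalities of the region\<close>

lemma wf_digraph_region_digraph: "wf_digraph (region_digraph A R)"
  by unfold_locales (auto simp: region_digraph_def)

lemma verts_region_digraph [simp]: "verts (region_digraph A R) = UNIV"
  by (simp add: region_digraph_def)

lemma region_digraph_dominates_iff:
  "i \<rightarrow>\<^bsub>region_digraph A R\<^esub> j \<longleftrightarrow>
     i < j \<and> lower_bounds A R i j > -\<infinity> \<or> j < i \<and> upper_bounds A R j i < \<infinity>"
  by (force simp: region_digraph_def arcs_ends_conv)

context
  fixes A :: "real set" and R :: "(real ^ 'n::{finite,linorder}) set"
  assumes fin: "finite A" and R: "R \<in> regions A"
begin

private abbreviation (input) "D \<equiv> region_digraph A R"

interpretation wf_digraph D
  by (rule wf_digraph_region_digraph)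

lemma mem_region_iff:
  "x \<in> R \<longleftrightarrow> (\<forall>i j. i < j \<longrightarrow> lower_bounds A R i j < ereal (x $ i - x $ j) \<and>
     ereal (x $ i - x $ j) < upper_bounds A R i j)"
  using is_region_system_lower_bounds[OF fin R]
  unfolding is_region_system_def upper_bounds_def by blast

text \<open>The weight of the arc is such a bound: a finite lower bound for a forward arc, a negated
  finite upper bound for a backward one.\<close>

lemma difference_bounded_below_of_arc:
  assumes "i \<rightarrow>\<^bsub>D\<^esub> j"
  shows "\<exists>c. \<forall>x\<in>R. c \<le> x $ i - x $ j"
  using assms unfolding region_digraph_dominates_iff
proof (elim disjE conjE)
  assume ij: "i < j" "lower_bounds A R i j > -\<infinity>"
  then have "lower_bounds A R i j \<in> insert (-\<infinity>) (ereal ` A)"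
    using is_region_system_lower_bounds[OF fin R] unfolding is_region_system_def by blast
  then obtain a where "lower_bounds A R i j = ereal a"
    using ij by auto
  then show ?thesis
    using ij mem_region_iff by (metis less_ereal.simps(1) less_imp_le)
next
  assume ji: "j < i" "upper_bounds A R j i < \<infinity>"
  then obtain a where a: "upper_bounds A R j i = ereal a"
    using next_bound_cases[OF fin, of "lower_bounds A R j i"] by (auto simp: upper_bounds_def)
  have "- a \<le> x $ i - x $ j" if "x \<in> R" for x
  proof -
    have "ereal (x $ j - x $ i) < ereal a"
      using ji(1) that a mem_region_iff by metis
    then show ?thesis by simp
  qed
  then show ?thesis by blast
qed

text \<open>Differences telescope along a walk, so the bounds of its arcs add up.\<close>

lemma difference_bounded_below_of_reachable:
  assumes "i \<rightarrow>\<^sup>*\<^bsub>D\<^esub> j"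
  shows "\<exists>c. \<forall>x\<in>R. c \<le> x $ i - x $ j"
  using assms
proof (induction rule: reachable_induct)
  case base
  show ?case by auto
next
  case (step u v)
  then obtain c d where "\<forall>x\<in>R. c \<le> x $ i - x $ u" "\<forall>x\<in>R. d \<le> x $ u - x $ v"
    using difference_bounded_below_of_arc by blast
  then have "\<forall>x\<in>R. c + d \<le> x $ i - x $ v"
    by fastforce
  then show ?case ..
qed

text \<open>Each finite bound of the system has its arc, and the condition on \<open>y\<close> says
  that moving along \<open>y\<close> never brings the difference closer to that bound. Infinite
  bounds hold trivially.\<close>

lemma region_recession_direction:
  assumes x: "x \<in> R" and t: "t \<ge> 0"
    and y: "\<And>i j. i \<rightarrow>\<^bsub>D\<^esub> j \<Longrightarrow> y $ j \<le> y $ i"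
  shows "x + t *\<^sub>R y \<in> R"
  unfolding mem_region_iff
proof (intro allI impI conjI)
  fix i j :: 'n assume ij: "i < j"
  let ?z = "x + t *\<^sub>R y"
  have z: "?z $ i - ?z $ j = (x $ i - x $ j) + t * (y $ i - y $ j)"
    by (simp add: algebra_simps)
  have xij: "lower_bounds A R i j < ereal (x $ i - x $ j)" "ereal (x $ i - x $ j) < upper_bounds A R i j"
    using x ij mem_region_iff by blast+
  show "lower_bounds A R i j < ereal (?z $ i - ?z $ j)"
  proof (cases "lower_bounds A R i j > -\<infinity>")
    case True
    then have "y $ j \<le> y $ i"
      using ij y by (simp add: region_digraph_dominates_iff)
    then have "x $ i - x $ j \<le> ?z $ i - ?z $ j"
      using t z by simp
    then show ?thesis
      using xij(1) by (meson ereal_less_eq(3) less_le_trans)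
  qed simp
  show "ereal (?z $ i - ?z $ j) < upper_bounds A R i j"
  proof (cases "upper_bounds A R i j < \<infinity>")
    case True
    then have "y $ i \<le> y $ j"
      using ij y by (simp add: region_digraph_dominates_iff)
    then have "?z $ i - ?z $ j \<le> x $ i - x $ j"
      using t z by (simp add: mult_nonneg_nonpos)
    then show ?thesis
      using xij(2) by (meson ereal_less_eq(3) le_less_trans)
  qed simp
qed

section \<open>The space of vectors constant on strong components\<close>

text \<open>This is \<open>W\<^sub>0\<close> of the overview.\<close>

definition component_space :: "(real, 'n) vec set" where
  "component_space = {x. \<forall>i j. i \<rightarrow>\<^sup>*\<^bsub>D\<^esub> j \<longrightarrow> j \<rightarrow>\<^sup>*\<^bsub>D\<^esub> i \<longrightarrow> x $ i = x $ j}"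

lemma subspace_component_space: "subspace component_space"
proof (rule subspaceI)
  show "0 \<in> component_space"
    by (simp add: component_space_def)
next
  fix x y assume xy: "x \<in> component_space" "y \<in> component_space"
  have "x $ i = x $ j" "y $ i = y $ j" if "i \<rightarrow>\<^sup>*\<^bsub>D\<^esub> j" "j \<rightarrow>\<^sup>*\<^bsub>D\<^esub> i" for i j
    using xy that unfolding component_space_def by blast+
  then show "x + y \<in> component_space"
    unfolding component_space_def mem_Collect_eq vector_add_component
    by (intro allI impI arg_cong2[where f = "(+)"])
next
  fix c x assume x: "x \<in> component_space"
  have "x $ i = x $ j" if "i \<rightarrow>\<^sup>*\<^bsub>D\<^esub> j" "j \<rightarrow>\<^sup>*\<^bsub>D\<^esub> i" for i j
    using x that unfolding component_space_def by blast
  then show "c *\<^sub>R x \<in> component_space"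
    unfolding component_space_def mem_Collect_eq vector_scaleR_component
    by (intro allI impI arg_cong[where f = "\<lambda>s. c *\<^sub>R s"])
qed

lemma dim_component_space:
  "dim component_space = card (pre_digraph.sccs D)"
proof -
  have "partition_on UNIV sccs_verts"
    using partition_on_sccs_verts by simp
  then show ?thesis
    unfolding component_space_def constant_on_sccs_verts_iff[symmetric] card_sccs_verts[symmetric]
    by (rule dim_constant_on_blocks)
qed

text \<open>Overwriting each coordinate by that of a representative of its component lands in the
  space. The displacement is bounded uniformly on \<open>R\<close>, as a vertex and its
  representative reach each other.\<close>

lemma region_near_component_space:
  "\<exists>r>0. R \<subseteq> {x. infdist x component_space \<le> r}"
proof -
  define mutual where "mutual i = {j. i \<rightarrow>\<^sup>*\<^bsub>D\<^esub> j \<and> j \<rightarrow>\<^sup>*\<^bsub>D\<^esub> i}" for i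
  define rep where "rep i = (SOME j. j \<in> mutual i)" for i
  have rep: "i \<rightarrow>\<^sup>*\<^bsub>D\<^esub> rep i" "rep i \<rightarrow>\<^sup>*\<^bsub>D\<^esub> i" for i
  proof -
    have "i \<in> mutual i"
      by (simp add: mutual_def)
    then have "rep i \<in> mutual i"
      unfolding rep_def by (rule someI)
    then show "i \<rightarrow>\<^sup>*\<^bsub>D\<^esub> rep i" "rep i \<rightarrow>\<^sup>*\<^bsub>D\<^esub> i"
      by (auto simp: mutual_def)
  qed
  have rep_eq: "rep i = rep j" if "i \<rightarrow>\<^sup>*\<^bsub>D\<^esub> j" "j \<rightarrow>\<^sup>*\<^bsub>D\<^esub> i" for i j
  proof -
    \<comment> \<open>\<open>SOME\<close> is applied to one and the same set, hence picks the same
      representative.\<close>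
    have "mutual i = mutual j"
      using that unfolding mutual_def by (auto intro: reachable_trans)
    then show ?thesis by (simp add: rep_def)
  qed
  have "\<exists>c. \<forall>x\<in>R. \<bar>x $ i - x $ rep i\<bar> \<le> c" for i
  proof -
    obtain c d where cd: "\<forall>x\<in>R. c \<le> x $ i - x $ rep i" "\<forall>x\<in>R. d \<le> x $ rep i - x $ i"
      using rep difference_bounded_below_of_reachable by meson
    have "\<bar>x $ i - x $ rep i\<bar> \<le> \<bar>c\<bar> + \<bar>d\<bar>" if "x \<in> R" for x
      using cd[THEN bspec, OF that] by linarith
    then show ?thesis by blast
  qed
  then obtain c where c: "\<And>i x. x \<in> R \<Longrightarrow> \<bar>x $ i - x $ rep i\<bar> \<le> c i"
    by metis
  \<comment> \<open>The summand 1 keeps \<open>r\<close> positive even if all \<open>c i\<close>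
    vanish.\<close>
  define r where "r = (\<Sum>i\<in>UNIV. \<bar>c i\<bar>) + 1"
  have "r > 0"
    unfolding r_def by (intro add_nonneg_pos sum_nonneg) auto
  moreover have "infdist x component_space \<le> r" if x: "x \<in> R" for x
  proof -
    define p where "p = (\<chi> i. x $ rep i)"
    have "p \<in> component_space"
      unfolding component_space_def mem_Collect_eq p_def vec_lambda_beta
      by (intro allI impI arg_cong[where f = "\<lambda>i. x $ i"] rep_eq)
    then have "infdist x component_space \<le> norm (x - p)"
      using infdist_le by (metis dist_norm)
    also have "\<dots> \<le> (\<Sum>i\<in>UNIV. \<bar>(x - p) $ i\<bar>)"
      by (rule norm_le_l1_cart)
    also have "\<dots> \<le> (\<Sum>i\<in>UNIV. \<bar>c i\<bar>)"
      using order_trans[OF c[OF x] abs_ge_self] by (intro sum_mono) (simp add: p_def)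
    finally show ?thesis by (simp add: r_def)
  qed
  ultimately show ?thesis by blast
qed

section \<open>Minimality and the level\<close>

lemma component_space_subset:
  assumes W: "subspace W" and RW: "R \<subseteq> {x. infdist x W \<le> r}"
  shows "component_space \<subseteq> W"
proof
  fix z assume z: "z \<in> component_space"
  obtain x where x: "x \<in> R"
    using R in_components_nonempty unfolding regions_def by blast
  have rec: "y \<in> W" if "\<And>i j. i \<rightarrow>\<^bsub>D\<^esub> j \<Longrightarrow> y $ j \<le> y $ i" for y
    using region_recession_direction[OF x _ that] RW
    by (intro recession_direction_in_subspace[OF W, of x y r]) blast
  define y :: "(real, 'n) vec" where "y = (\<chi> i. real (card {k. i \<rightarrow>\<^sup>*\<^bsub>D\<^esub> k}))"
  have y_mono: "y $ j \<le> y $ i" if "i \<rightarrow>\<^sup>*\<^bsub>D\<^esub> j" for i j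
    using that by (auto simp: y_def intro!: card_mono intro: reachable_trans)
  have y_drop: "y $ j + 1 \<le> y $ i" if "i \<rightarrow>\<^sup>*\<^bsub>D\<^esub> j" "\<not> j \<rightarrow>\<^sup>*\<^bsub>D\<^esub> i" for i j
  proof -
    \<comment> \<open>The vertex \<open>i\<close> makes the inclusion of reachable sets strict: it
      is reachable from \<open>i\<close> but not from \<open>j\<close>.\<close>
    have "i \<rightarrow>\<^sup>*\<^bsub>D\<^esub> i"
      by simp
    then have "{k. j \<rightarrow>\<^sup>*\<^bsub>D\<^esub> k} \<subset> {k. i \<rightarrow>\<^sup>*\<^bsub>D\<^esub> k}"
      using that by (auto intro: reachable_trans)
    then have "card {k. j \<rightarrow>\<^sup>*\<^bsub>D\<^esub> k} < card {k. i \<rightarrow>\<^sup>*\<^bsub>D\<^esub> k}"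
      by (intro psubset_card_mono) auto
    then show ?thesis by (simp add: y_def)
  qed
  \<comment> \<open>Two coordinates of \<open>z\<close> differ by at most \<open>2 * norm z\<close>,
    so the drop of \<open>t *\<^sub>R y\<close> along an arc between components outweighs any rise
    of \<open>z\<close>.\<close>
  define t where "t = 2 * norm z"
  have "y \<in> W"
    using y_mono by (intro rec) auto
  moreover have "z + t *\<^sub>R y \<in> W"
  proof (rule rec)
    fix i j assume ij: "i \<rightarrow>\<^bsub>D\<^esub> j"
    show "(z + t *\<^sub>R y) $ j \<le> (z + t *\<^sub>R y) $ i"
    proof (cases "j \<rightarrow>\<^sup>*\<^bsub>D\<^esub> i")
      case True
      then have "z $ i = z $ j" "y $ i = y $ j"
        using ij z y_mono[of i j] y_mono[of j i] by (auto simp: component_space_def)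
      then show ?thesis by simp
    next
      case False
      have "z $ j - z $ i \<le> t"
        using component_le_norm_cart[of z i] component_le_norm_cart[of z j] by (simp add: t_def)
      also have "t * 1 \<le> t * (y $ i - y $ j)"
        using y_drop[of i j] ij False by (intro mult_left_mono) (auto simp: t_def)
      then have "t \<le> t * (y $ i - y $ j)" by simp
      finally show ?thesis by (simp add: algebra_simps)
    qed
  qed
  ultimately have "(z + t *\<^sub>R y) - t *\<^sub>R y \<in> W"
    using W by (intro subspace_diff subspace_scale)
  then show "z \<in> W" by simp
qed

text \<open>\<open>component_space\<close> itself attains the minimum, and every competing subspace
  contains it.\<close>

lemma level_region: "level R = dim component_space"
  unfolding level_def
proof (rule Least_equality)
  show "\<exists>W r. subspace W \<and> dim W = dim component_space \<and> r > 0 \<and> R \<subseteq> {x. infdist x W \<le> r}"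
    using subspace_component_space region_near_component_space by blast
  show "dim component_space \<le> l"
    if "\<exists>W r. subspace W \<and> dim W = l \<and> r > 0 \<and> R \<subseteq> {x. infdist x W \<le> r}" for l
    using that by (metis component_space_subset dim_subset)
qed

end

theorem theorem2p7:
  fixes A :: "real set" and R :: "(real ^ 'n::{finite,linorder}) set"
  assumes "finite A"
    and "R \<in> regions A"
  shows "level R = card (pre_digraph.sccs (region_digraph A R))"
  using level_region[OF assms] dim_component_space[OF assms] by (rule trans)

end
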